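(* Let $M\ge 1$, $R_1,\dots,R_M\in\mathbb{R}^3$, $Z_1,\dots,Z_M>0$, $d>0$, and put $Z:=\sum_{\alpha=1}^M Z_\alpha$. For $N\in\mathbb{N}$ let $V_{N,\underline{Z}}$ and $\mathcal{A}_N$ be as defined in the context. a) If $N\le Z+1$, then there exists a minimizer of $V_{N,\underline{Z}}$ on $\mathcal{A}_N$. b) For every $N\in\mathbb{N}$, every minimizer $(x_1,\dots,x_N)$ of $V_{N,\underline{Z}}$ on $\mathcal{A}_N$ satisfies $x_i\in\bigcup_{\alpha=1}^M S_\alpha$ for all $i=1,\dots,N$, where $S_\alpha=\{x\in\mathbb{R}^3 : |x-R_\alpha|=d\}$.
   Context: For $\underline{Z}=(Z_1,\dots,Z_M)$ with $Z_\alpha>0$ (real numbers), define $$V_{N,\underline{Z}}(x_1,\dots,x_N):=\sum_{i=1}^N v(x_i)+\sum_{1\le i<j\le N}\frac{1}{|x_i-x_j|},\qquad v(x)=\sum_{\alpha=1}^M\frac{-Z_\alpha}{|x-R_\alpha|},$$ with the convention $1/0=+\infty$, so that $V_{N,\underline{Z}}=+\infty$ when two of the $x_i$ coincide. The admissible set is $$\mathcal{A}_N:=\{(x_1,\dots,x_N)\in\mathbb{R}^{3N} : |x_i-R_\alpha|\ge d\text{ for all } i,\alpha\}.$$ *)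

theory Defs
  imports "HOL-Analysis.Analysis"
begin

text \<open>
  The nuclei have positions \<open>R \<alpha>\<close> and charges \<open>Z \<alpha>\<close> for \<open>\<alpha> \<in> {1..M}\<close>. All energies are extended
  reals: there \<open>1 / 0 = \<infinity>\<close>, whereas real division would give \<open>1 / 0 = 0\<close>.
\<close>

definition ext_potential ::
    "nat \<Rightarrow> (nat \<Rightarrow> real ^ 3) \<Rightarrow> (nat \<Rightarrow> real) \<Rightarrow> real ^ 3 \<Rightarrow> ereal" where
  "ext_potential M R Z x = (\<Sum>\<alpha>=1..M. ereal (- Z \<alpha>) / ereal (norm (x - R \<alpha>)))"

definition total_potential ::
    "nat \<Rightarrow> (nat \<Rightarrow> real ^ 3) \<Rightarrow> (nat \<Rightarrow> real) \<Rightarrow> nat \<Rightarrow> (nat \<Rightarrow> real ^ 3) \<Rightarrow> ereal" where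
  "total_potential M R Z N x =
     (\<Sum>i=1..N. ext_potential M R Z (x i)) +
     (\<Sum>(i, j) \<in> {(i, j). 1 \<le> i \<and> i < j \<and> j \<le> N}. 1 / ereal (norm (x i - x j)))"

text \<open>
  An \<open>N\<close>-tuple of points is a function on \<open>{1..N}\<close>, extended by \<open>undefined\<close> outside, so that
  \<open>{1..N} \<rightarrow>\<^sub>E UNIV\<close> is the space of all such tuples.
\<close>

definition admissible ::
    "nat \<Rightarrow> (nat \<Rightarrow> real ^ 3) \<Rightarrow> real \<Rightarrow> nat \<Rightarrow> (nat \<Rightarrow> real ^ 3) set" where
  "admissible M R d N =
     {x \<in> {1..N} \<rightarrow>\<^sub>E UNIV. \<forall>i\<in>{1..N}. \<forall>\<alpha>\<in>{1..M}. norm (x i - R \<alpha>) \<ge> d}"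

lemma total_potential_coincident:
  assumes "1 \<le> i" "i < j" "j \<le> N" "x i = x j"
  shows "total_potential M R Z N x = \<infinity>"
proof -
  let ?P = "{(i, j). 1 \<le> i \<and> i < j \<and> j \<le> N}"
  have "finite ?P"
    by (rule finite_subset[of _ "{1..N} \<times> {1..N}"]) auto
  moreover have "(i, j) \<in> ?P" "(case (i, j) of (i, j) \<Rightarrow> 1 / ereal (norm (x i - x j))) = \<infinity>"
    using assms by (auto simp: divide_ereal_def)
  ultimately have "(\<Sum>(i, j) \<in> ?P. 1 / ereal (norm (x i - x j))) = \<infinity>"
    unfolding sum_Pinfty by blast
  then show ?thesis
    by (simp add: total_potential_def)
qed

end

theory Submission
  imports Defs "HOL-Complex_Analysis.Conformal_Mappings"
begin

text \<open>
  With the other points fixed, the energy is, as a function of one point, a constant plus a finite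
  sum of Coulomb potentials, which is harmonic off its poles. Such a sum has no local minimum off
  its poles: by Hopf's argument it would be locally constant there, and by analytic continuation
  along a segment to a nearest pole it could not blow up at that pole. This is part b).

  For part a), induct on \<open>N\<close>. Given a minimizer for \<open>n \<le> Z\<close> electrons, the potential it creates has
  nonpositive total charge and is therefore negative at some remote point; placing an electron there
  shows that the infimum for \<open>n + 1\<close> electrons lies strictly below the one for \<open>n\<close>. Hence no electron
  can escape to infinity, and minimizing over a compact set suffices.
\<close>

section \<open>Harmonic functions\<close>

text \<open>The bound N \<le> Z + 1 enters through one sign: the last of n + 1 electrons feels poles
  of total charge n - Z, which is then at most 0. In the neutral case n = Z the leading term at
  infinity vanishes and does not decide the sign of the potential, so existence, too, rests on the
  absence of local minima. Nuclei may coincide, hence poles are indexed families. Charges meeting at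
  one point have equal sign because \<open>d > 0\<close> keeps electrons off the nuclei; opposite
  charges could cancel and leave a constant potential. Analyticity is used only along a line, in one
  complex variable; in space the second-order test and a barrier suffice.\<close>

text \<open>
  Symmetric second differences instead of derivatives: the second-order test at a local minimum is
  then immediate.
\<close>

definition has_laplacian :: "('a::euclidean_space \<Rightarrow> real) \<Rightarrow> real \<Rightarrow> 'a \<Rightarrow> bool" where
  "has_laplacian f L x \<longleftrightarrow>
     ((\<lambda>t. \<Sum>b\<in>Basis. (f (x + t *\<^sub>R b) + f (x - t *\<^sub>R b) - 2 * f x) / t\<^sup>2) \<longlongrightarrow> L) (at_right 0)"

lemma has_laplacian_const: "has_laplacian (\<lambda>_. c) 0 x"
  by (simp add: has_laplacian_def)

lemma has_laplacian_add:
  assumes "has_laplacian f K x" "has_laplacian g L x"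
  shows "has_laplacian (\<lambda>y. f y + g y) (K + L) x"
proof -
  have "(\<Sum>b\<in>Basis. (f (x + t *\<^sub>R b) + f (x - t *\<^sub>R b) - 2 * f x) / t\<^sup>2) +
        (\<Sum>b\<in>Basis. (g (x + t *\<^sub>R b) + g (x - t *\<^sub>R b) - 2 * g x) / t\<^sup>2) =
        (\<Sum>b\<in>Basis. (f (x + t *\<^sub>R b) + g (x + t *\<^sub>R b) + (f (x - t *\<^sub>R b) + g (x - t *\<^sub>R b))
           - 2 * (f x + g x)) / t\<^sup>2)" for t
    unfolding sum.distrib[symmetric] by (intro sum.cong refl) (simp add: field_simps flip: add_divide_distrib)
  with tendsto_add[OF assms[unfolded has_laplacian_def]] show ?thesis
    by (simp add: has_laplacian_def)
qed

lemma has_laplacian_cmult: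
  assumes "has_laplacian f L x"
  shows "has_laplacian (\<lambda>y. c * f y) (c * L) x"
proof -
  have "c * (\<Sum>b\<in>Basis. (f (x + t *\<^sub>R b) + f (x - t *\<^sub>R b) - 2 * f x) / t\<^sup>2) =
        (\<Sum>b\<in>Basis. (c * f (x + t *\<^sub>R b) + c * f (x - t *\<^sub>R b) - 2 * (c * f x)) / t\<^sup>2)" for t
    unfolding sum_distrib_left by (intro sum.cong refl) (simp add: algebra_simps)
  with tendsto_mult_left[OF assms[unfolded has_laplacian_def], of c] show ?thesis
    by (simp add: has_laplacian_def)
qed

lemma has_laplacian_sum:
  assumes "\<And>k. k \<in> K \<Longrightarrow> has_laplacian (f k) (L k) x"
  shows "has_laplacian (\<lambda>y. \<Sum>k\<in>K. f k y) (\<Sum>k\<in>K. L k) x"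
  using assms
  by (induction K rule: infinite_finite_induct)
    (auto intro!: has_laplacian_const has_laplacian_add)

lemma has_laplacian_nonneg_if_local_min:
  assumes "has_laplacian f L x" "r > 0" "\<And>y. y \<in> ball x r \<Longrightarrow> f x \<le> f y"
  shows "L \<ge> 0"
proof (rule tendsto_lowerbound[OF assms(1)[unfolded has_laplacian_def]])
  have "\<forall>\<^sub>F t in at_right (0::real). t < r"
    by (rule order_tendstoD(2)[of _ 0]) (use \<open>r > 0\<close> in auto)
  moreover have "\<forall>\<^sub>F t in at_right (0::real). t > 0"
    by (simp add: eventually_at_right_less)
  ultimately show "\<forall>\<^sub>F t in at_right 0. 0 \<le> (\<Sum>b\<in>Basis. (f (x + t *\<^sub>R b) + f (x - t *\<^sub>R b) - 2 * f x) / t\<^sup>2)"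
  proof eventually_elim
    case (elim t)
    then have "f x \<le> f (x + t *\<^sub>R b)" "f x \<le> f (x - t *\<^sub>R b)" if "b \<in> Basis" for b
      using that by (auto intro!: assms(3) simp: dist_norm)
    then show ?case
      by (intro sum_nonneg divide_nonneg_nonneg) (smt (verit), simp)
  qed
qed simp

section \<open>Laplacians of the Coulomb kernel and of the barrier\<close>

lemma norm_add_scaleR_Basis_sq:
  fixes v :: "'a::euclidean_space"
  assumes "b \<in> Basis"
  shows "(norm (v + t *\<^sub>R b))\<^sup>2 = (norm v)\<^sup>2 + 2 * t * (v \<bullet> b) + t\<^sup>2"
        "(norm (v - t *\<^sub>R b))\<^sup>2 = (norm v)\<^sup>2 - 2 * t * (v \<bullet> b) + t\<^sup>2"
  using assms unfolding power2_norm_eq_inner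
  by (simp_all add: inner_add_left inner_add_right inner_diff_left inner_diff_right
      inner_commute[of b v] inner_same_Basis power2_eq_square algebra_simps)

lemma sum_inner_Basis_sq: "(\<Sum>b\<in>Basis. (v \<bullet> b)\<^sup>2) = (norm (v::'a::euclidean_space))\<^sup>2"
  using euclidean_inner[of v v] by (simp add: power2_norm_eq_inner flip: power2_eq_square)

text \<open>Writing 1/P - 1/r as (r^2 - P^2) / (r P (r + P)) and inserting the squared distances
  cancels \<open>t\<^sup>2\<close> exactly. The limit as t tends to 0 can then be read off term by
  term, without a Taylor expansion.\<close>

lemma second_difference_inverse:
  fixes P Q r \<beta> t :: real
  assumes "P > 0" "Q > 0" "r > 0" "t \<noteq> 0"
    and P: "P\<^sup>2 = r\<^sup>2 + 2 * t * \<beta> + t\<^sup>2" and Q: "Q\<^sup>2 = r\<^sup>2 - 2 * t * \<beta> + t\<^sup>2"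
  shows "(1 / P + 1 / Q - 2 * (1 / r)) / t\<^sup>2 =
    8 * \<beta>\<^sup>2 * (r + P + Q) / ((P + Q) * (r * P * Q * (r + P) * (r + Q)))
      - 1 / (r * P * (r + P)) - 1 / (r * Q * (r + Q))"
proof -
  define X where "X = 1 / (r * P * (r + P))"
  define Y where "Y = 1 / (r * Q * (r + Q))"
  have nz: "r + P > 0" "r + Q > 0" "P + Q > 0"
    using assms by auto
  have "(r\<^sup>2 - P\<^sup>2) * X = 1 / P - 1 / r" "(r\<^sup>2 - Q\<^sup>2) * Y = 1 / Q - 1 / r"
    using assms(1-3) nz
    by (simp_all add: X_def Y_def power2_eq_square square_diff_square_factored diff_frac_eq mult.commute)
  then have "1 / P + 1 / Q - 2 * (1 / r) = (r\<^sup>2 - P\<^sup>2) * X + (r\<^sup>2 - Q\<^sup>2) * Y"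
    by simp
  also have "\<dots> = - t\<^sup>2 * (X + Y) + 2 * t * \<beta> * (Y - X)"
    unfolding P Q by (simp add: algebra_simps)
  finally have "1 / P + 1 / Q - 2 * (1 / r) = - t\<^sup>2 * (X + Y) + 2 * t * \<beta> * (Y - X)" .
  moreover have "Y - X = (P - Q) * ((r + P + Q) / (r * P * Q * (r + P) * (r + Q)))"
  proof -
    have "Y - X = (r * P * (r + P) - r * Q * (r + Q)) / ((r * Q * (r + Q)) * (r * P * (r + P)))"
      using assms(1-3) nz by (simp add: X_def Y_def diff_frac_eq)
    also have "r * P * (r + P) - r * Q * (r + Q) = r * ((P - Q) * (r + P + Q))"
      by algebra
    also have "(r * Q * (r + Q)) * (r * P * (r + P)) = r * (r * P * Q * (r + P) * (r + Q))"
      by algebra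
    finally show ?thesis
      using assms(3) by simp
  qed
  moreover have "P - Q = 4 * t * \<beta> / (P + Q)"
  proof -
    have "(P - Q) * (P + Q) = 4 * t * \<beta>"
      using P Q by (simp add: algebra_simps power2_eq_square)
    then show ?thesis
      using nz by (simp add: eq_divide_eq)
  qed
  ultimately have "1 / P + 1 / Q - 2 * (1 / r) =
     t\<^sup>2 * (8 * \<beta>\<^sup>2 / (P + Q) * ((r + P + Q) / (r * P * Q * (r + P) * (r + Q))) - X - Y)"
    by (simp add: algebra_simps power2_eq_square)
  then show ?thesis
    using \<open>t \<noteq> 0\<close> by (simp add: X_def Y_def)
qed

lemma second_difference_inverse_sq:
  fixes A B D \<beta> t :: real
  assumes "A > 0" "B > 0" "D > 0" "t \<noteq> 0"
    and A: "A = D + 2 * t * \<beta> + t\<^sup>2" and B: "B = D - 2 * t * \<beta> + t\<^sup>2"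
  shows "(1 / A + 1 / B - 2 * (1 / D)) / t\<^sup>2 = (8 * \<beta>\<^sup>2 - 2 * (D + t\<^sup>2)) / (D * A * B)"
proof -
  have "D * (A + B) - 2 * (A * B) = t\<^sup>2 * (8 * \<beta>\<^sup>2 - 2 * (D + t\<^sup>2))"
    unfolding A B by algebra
  moreover have "1 / A + 1 / B - 2 * (1 / D) = (D * (A + B) - 2 * (A * B)) / (D * A * B)"
    using assms(1-3) by (simp add: field_simps)
  ultimately show ?thesis
    using \<open>t \<noteq> 0\<close> by simp
qed

lemma tendsto_norm_add_scaleR:
  fixes v b :: "'a::real_normed_vector"
  shows "((\<lambda>t. norm (v + t *\<^sub>R b)) \<longlongrightarrow> norm v) (at_right 0)"
        "((\<lambda>t. norm (v - t *\<^sub>R b)) \<longlongrightarrow> norm v) (at_right 0)"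
proof -
  have "((\<lambda>t. norm (v + t *\<^sub>R b)) \<longlongrightarrow> norm (v + 0 *\<^sub>R b)) (at_right 0)"
       "((\<lambda>t. norm (v - t *\<^sub>R b)) \<longlongrightarrow> norm (v - 0 *\<^sub>R b)) (at_right 0)"
    by (intro tendsto_intros)+
  then show "((\<lambda>t. norm (v + t *\<^sub>R b)) \<longlongrightarrow> norm v) (at_right 0)"
       "((\<lambda>t. norm (v - t *\<^sub>R b)) \<longlongrightarrow> norm v) (at_right 0)"
    by simp_all
qed

text \<open>Dimension three makes the limits cancel: direction b contributes 3 (v \<bullet> b)^2 /
  r^5 - 1 / r^3; the squares add up to r^2, and the second term is counted three times.\<close>

lemma has_laplacian_coulomb:
  fixes x a :: "real ^ 3"
  assumes "x \<noteq> a"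
  shows "has_laplacian (\<lambda>y. 1 / norm (y - a)) 0 x"
proof -
  define v where "v = x - a"
  define r where "r = norm v"
  have "r > 0"
    using assms by (simp add: v_def r_def)
  let ?g = "\<lambda>b t. 8 * (v \<bullet> b)\<^sup>2 * (r + norm (v + t *\<^sub>R b) + norm (v - t *\<^sub>R b)) /
         ((norm (v + t *\<^sub>R b) + norm (v - t *\<^sub>R b)) * (r * norm (v + t *\<^sub>R b) * norm (v - t *\<^sub>R b)
             * (r + norm (v + t *\<^sub>R b)) * (r + norm (v - t *\<^sub>R b))))
      - 1 / (r * norm (v + t *\<^sub>R b) * (r + norm (v + t *\<^sub>R b)))
      - 1 / (r * norm (v - t *\<^sub>R b) * (r + norm (v - t *\<^sub>R b)))"
  have "((\<lambda>t. (1 / norm (v + t *\<^sub>R b) + 1 / norm (v - t *\<^sub>R b) - 2 * (1 / r)) / t\<^sup>2)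
          \<longlongrightarrow> 3 * (v \<bullet> b)\<^sup>2 / r ^ 5 - 1 / r ^ 3) (at_right 0)"
    if "b \<in> Basis" for b
  proof (rule Lim_transform_eventually)
    have "(?g b \<longlongrightarrow> 8 * (v \<bullet> b)\<^sup>2 * (r + r + r) / ((r + r) * (r * r * r * (r + r) * (r + r)))
        - 1 / (r * r * (r + r)) - 1 / (r * r * (r + r))) (at_right 0)"
      using \<open>r > 0\<close> by (intro tendsto_intros tendsto_norm_add_scaleR[of v, folded r_def]) auto
    also have "8 * (v \<bullet> b)\<^sup>2 * (r + r + r) / ((r + r) * (r * r * r * (r + r) * (r + r)))
        - 1 / (r * r * (r + r)) - 1 / (r * r * (r + r)) = 3 * (v \<bullet> b)\<^sup>2 / r ^ 5 - 1 / r ^ 3"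
      using \<open>r > 0\<close> by (simp add: field_simps power_numeral_reduce)
    finally show "(?g b \<longlongrightarrow> 3 * (v \<bullet> b)\<^sup>2 / r ^ 5 - 1 / r ^ 3) (at_right 0)" .
    have "\<forall>\<^sub>F t in at_right 0. norm (v + t *\<^sub>R b) > 0" "\<forall>\<^sub>F t in at_right 0. norm (v - t *\<^sub>R b) > 0"
      using \<open>r > 0\<close> unfolding r_def by (intro order_tendstoD(1)[OF tendsto_norm_add_scaleR(1)] order_tendstoD(1)[OF tendsto_norm_add_scaleR(2)]; simp)+
    moreover have "\<forall>\<^sub>F t in at_right (0::real). t > 0"
      by (simp add: eventually_at_right_less)
    ultimately show "\<forall>\<^sub>F t in at_right 0. ?g b t =
         (1 / norm (v + t *\<^sub>R b) + 1 / norm (v - t *\<^sub>R b) - 2 * (1 / r)) / t\<^sup>2"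
    proof eventually_elim
      case (elim t)
      then show ?case
        unfolding r_def
        by (intro second_difference_inverse[symmetric] norm_add_scaleR_Basis_sq[OF that])
          (use \<open>r > 0\<close> in \<open>auto simp: r_def\<close>)
    qed
  qed
  then have "((\<lambda>t. \<Sum>b\<in>Basis. (1 / norm (v + t *\<^sub>R b) + 1 / norm (v - t *\<^sub>R b) - 2 * (1 / r)) / t\<^sup>2)
          \<longlongrightarrow> (\<Sum>b\<in>Basis. 3 * (v \<bullet> b)\<^sup>2 / r ^ 5 - 1 / r ^ 3)) (at_right 0)"
    by (intro tendsto_sum)
  moreover have "(\<Sum>b\<in>Basis. 3 * (v \<bullet> b)\<^sup>2 / r ^ 5 - 1 / r ^ 3) = 3 * r\<^sup>2 / r ^ 5 - 3 / r ^ 3"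
    unfolding r_def sum_inner_Basis_sq[symmetric]
    by (simp add: sum_subtractf sum_distrib_left sum_divide_distrib)
  moreover have "3 * r\<^sup>2 / r ^ 5 - 3 / r ^ 3 = 0"
    using \<open>r > 0\<close> by (simp add: field_simps power_numeral_reduce)
  ultimately show ?thesis
    by (simp add: has_laplacian_def v_def r_def algebra_simps)
qed

text \<open>In dimension three |x|^(-s) has Laplacian s (s - 1) |x|^(-s - 2). The Coulomb kernel is
  the case s = 1; s = 2 gives a positive value and involves no square roots.\<close>

lemma has_laplacian_inverse_norm_sq:
  fixes x a :: "real ^ 3"
  assumes "x \<noteq> a"
  shows "has_laplacian (\<lambda>y. 1 / (norm (y - a))\<^sup>2) (2 / norm (x - a) ^ 4) x"
proof -
  define v where "v = x - a"
  define D where "D = (norm v)\<^sup>2"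
  have "D > 0" "norm v > 0"
    using assms by (simp_all add: v_def D_def)
  let ?g = "\<lambda>b t. (8 * (v \<bullet> b)\<^sup>2 - 2 * (D + t\<^sup>2)) / (D * (norm (v + t *\<^sub>R b))\<^sup>2 * (norm (v - t *\<^sub>R b))\<^sup>2)"
  have "((\<lambda>t. (1 / (norm (v + t *\<^sub>R b))\<^sup>2 + 1 / (norm (v - t *\<^sub>R b))\<^sup>2 - 2 * (1 / D)) / t\<^sup>2)
          \<longlongrightarrow> (8 * (v \<bullet> b)\<^sup>2 - 2 * D) / D ^ 3) (at_right 0)"
    if "b \<in> Basis" for b
  proof (rule Lim_transform_eventually)
    have "(?g b \<longlongrightarrow> (8 * (v \<bullet> b)\<^sup>2 - 2 * (D + 0\<^sup>2)) / (D * (norm v)\<^sup>2 * (norm v)\<^sup>2)) (at_right 0)"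
      using \<open>D > 0\<close> \<open>norm v > 0\<close> by (intro tendsto_intros tendsto_norm_add_scaleR) auto
    then show "(?g b \<longlongrightarrow> (8 * (v \<bullet> b)\<^sup>2 - 2 * D) / D ^ 3) (at_right 0)"
      by (simp add: D_def power3_eq_cube)
    have "\<forall>\<^sub>F t in at_right 0. norm (v + t *\<^sub>R b) > 0" "\<forall>\<^sub>F t in at_right 0. norm (v - t *\<^sub>R b) > 0"
      using \<open>norm v > 0\<close> by (intro order_tendstoD(1)[OF tendsto_norm_add_scaleR(1)] order_tendstoD(1)[OF tendsto_norm_add_scaleR(2)]; simp)+
    moreover have "\<forall>\<^sub>F t in at_right (0::real). t > 0"
      by (simp add: eventually_at_right_less)
    ultimately show "\<forall>\<^sub>F t in at_right 0. ?g b t =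
         (1 / (norm (v + t *\<^sub>R b))\<^sup>2 + 1 / (norm (v - t *\<^sub>R b))\<^sup>2 - 2 * (1 / D)) / t\<^sup>2"
    proof eventually_elim
      case (elim t)
      then show ?case
        unfolding D_def
        by (intro second_difference_inverse_sq[symmetric] norm_add_scaleR_Basis_sq[OF that])
          (use \<open>norm v > 0\<close> in auto)
    qed
  qed
  then have "((\<lambda>t. \<Sum>b\<in>Basis. (1 / (norm (v + t *\<^sub>R b))\<^sup>2 + 1 / (norm (v - t *\<^sub>R b))\<^sup>2 - 2 * (1 / D)) / t\<^sup>2)
          \<longlongrightarrow> (\<Sum>b\<in>Basis. (8 * (v \<bullet> b)\<^sup>2 - 2 * D) / D ^ 3)) (at_right 0)"
    by (intro tendsto_sum)
  moreover have "(\<Sum>b\<in>Basis. (8 * (v \<bullet> b)\<^sup>2 - 2 * D) / D ^ 3) = (8 * D - 6 * D) / D ^ 3"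
    unfolding sum_divide_distrib[symmetric]
    by (simp add: sum_subtractf D_def sum_inner_Basis_sq flip: sum_distrib_left)
  moreover have "(8 * D - 6 * D) / D ^ 3 = 2 / norm v ^ 4"
    using \<open>D > 0\<close> by (simp add: D_def divide_simps power_numeral_reduce)
  ultimately show ?thesis
    by (simp add: has_laplacian_def v_def D_def algebra_simps)
qed

text \<open>
  Hopf's argument: \<open>z\<close> is a zero of \<open>f - f p\<close> nearest to \<open>y\<close>, and the ball around the midpoint \<open>m\<close> of
  \<open>y\<close> and \<open>z\<close> touches the zero set only in \<open>z\<close>. The barrier \<open>1 / |x - m|\<^sup>2\<close> is strictly
  subharmonic, so subtracting a small multiple of it makes \<open>f\<close> strictly superharmonic near \<open>z\<close> and
  yet leaves it with an interior minimum.
\<close>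

lemma harmonic_local_min_locally_constant:
  fixes f :: "real ^ 3 \<Rightarrow> real"
  assumes "r > 0" and cont: "continuous_on (ball p r) f"
    and harmonic: "\<And>x. x \<in> ball p r \<Longrightarrow> has_laplacian f 0 x"
    and min: "\<And>x. x \<in> ball p r \<Longrightarrow> f p \<le> f x"
    and y: "y \<in> ball p (r / 2)"
  shows "f y = f p"
proof (rule ccontr)
  assume neq: "f y \<noteq> f p"
  \<comment> \<open>Contains \<open>p\<close>, so a nearest point exists. The ball around
    \<open>y\<close> through \<open>p\<close> stays in \<open>ball p r\<close> because
    \<open>y\<close> is within r / 2 of \<open>p\<close>.\<close>
  define C where "C = {x \<in> cball y (dist y p). f x = f p}"
  have sub: "cball y (dist y p) \<subseteq> ball p r"
  proof
    fix x assume "x \<in> cball y (dist y p)"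
    then show "x \<in> ball p r"
      using y dist_triangle[of p x y] by (simp add: dist_commute)
  qed
  have "closed C"
    unfolding C_def by (intro continuous_closed_preimage_constant continuous_on_subset[OF cont sub]) simp
  moreover have "p \<in> C"
    by (simp add: C_def)
  ultimately obtain z where "z \<in> C" and nearest: "\<And>x. x \<in> C \<Longrightarrow> dist y z \<le> dist y x"
    using distance_attains_inf[of C y] by blast
  define \<sigma> where "\<sigma> = dist y z / 2"
  define m where "m = midpoint y z"
  \<comment> \<open>The first bound keeps \<open>cball z s\<close> away from \<open>m\<close>, the
    pole of the barrier; the second keeps it in \<open>ball p r\<close>, as z has distance at most 2
    |p - y| from p.\<close>
  define s where "s = min (\<sigma> / 2) ((r - 2 * dist p y) / 2)"
  have "y \<noteq> z" "f z = f p" "dist y z \<le> dist y p"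
    using neq \<open>z \<in> C\<close> by (auto simp: C_def)
  then have "\<sigma> > 0"
    by (simp add: \<sigma>_def)
  have "2 * dist p y < r"
    using y by simp
  then have "s > 0" "s \<le> \<sigma> / 2" "2 * dist p y + s < r"
    using \<open>\<sigma> > 0\<close> by (auto simp: s_def min_def field_simps)
  have "dist m z = \<sigma>"
    by (simp add: m_def \<sigma>_def dist_midpoint)
  have subz: "cball z s \<subseteq> ball p r"
  proof
    fix x assume "x \<in> cball z s"
    then show "x \<in> ball p r"
      using \<open>2 * dist p y + s < r\<close> \<open>dist y z \<le> dist y p\<close>
        dist_triangle[of p x z] dist_triangle[of p z y] by (simp add: dist_commute)
  qed
  \<comment> \<open>Parallelogram law: with a = m - y = z - m and b = x - m, the point x = y + a + b
    is strictly nearer to y than z is, hence outside \<open>C\<close>.\<close>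
  have gt: "f x > f p" if "x \<in> cball m \<sigma>" "x \<noteq> z" for x
  proof -
    define a b where "a = m - y" and "b = x - m"
    have a: "a = z - m"
      unfolding a_def m_def midpoint_def by (simp add: algebra_simps flip: scaleR_2)
    have "norm a = \<sigma>" "norm b \<le> \<sigma>"
      using \<open>dist m z = \<sigma>\<close> that(1) unfolding a b_def by (simp_all add: dist_norm norm_minus_commute)
    have "a - b \<noteq> 0"
      using that(2) by (simp add: a b_def)
    then have "0 < (norm (a - b))\<^sup>2"
      by simp
    also have "\<dots> = 2 * (norm a)\<^sup>2 + 2 * (norm b)\<^sup>2 - (norm (a + b))\<^sup>2"
      by (simp add: power2_norm_eq_inner inner_add_left inner_add_right inner_diff_left
          inner_diff_right inner_commute[of b a])
    finally have "(norm (a + b))\<^sup>2 < 2 * \<sigma>\<^sup>2 + 2 * (norm b)\<^sup>2"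
      using \<open>norm a = \<sigma>\<close> by simp
    also have "\<dots> \<le> (2 * \<sigma>)\<^sup>2"
      using \<open>norm b \<le> \<sigma>\<close> power_mono[of "norm b" \<sigma> 2] by simp
    finally have "norm (a + b) < 2 * \<sigma>"
      using \<open>\<sigma> > 0\<close> by (intro power2_less_imp_less[of _ "2 * \<sigma>"]) auto
    then have less: "dist y x < dist y z"
      by (simp add: a_def b_def \<sigma>_def dist_norm norm_minus_commute)
    then have "x \<notin> C"
      using nearest[of x] by auto
    moreover have "x \<in> cball y (dist y p)"
      using less \<open>dist y z \<le> dist y p\<close> by simp
    ultimately have "f x \<noteq> f p"
      by (simp add: C_def)
    with min[of x] sub \<open>x \<in> cball y (dist y p)\<close> show ?thesis
      by fastforce
  qed
  define T where "T = sphere z s \<inter> cball m \<sigma>"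
  obtain c where "c > 0" and c: "\<And>x. x \<in> T \<Longrightarrow> f p + c \<le> f x"
  proof (cases "T = {}")
    case False
    have "compact T"
      unfolding T_def by (intro compact_Int_closed) auto
    moreover have "continuous_on T f"
      by (rule continuous_on_subset[OF cont]) (use subz in \<open>auto simp: T_def\<close>)
    ultimately obtain x0 where "x0 \<in> T" "\<And>x. x \<in> T \<Longrightarrow> f x0 \<le> f x"
      using continuous_attains_inf[of T f] False by auto
    moreover have "f x0 > f p"
      using gt[of x0] \<open>x0 \<in> T\<close> \<open>s > 0\<close> by (auto simp: T_def)
    ultimately show ?thesis
      using that[of "f x0 - f p"] by auto
  qed (use that[of 1] in auto)
  \<comment> \<open>On \<open>T\<close> the barrier is at most 4 / \<sigma>^2, so this multiple of
    it stays within the margin \<open>c\<close>.\<close>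
  define \<epsilon> where "\<epsilon> = c * \<sigma>\<^sup>2 / 4"
  have "\<epsilon> > 0"
    using \<open>c > 0\<close> \<open>\<sigma> > 0\<close> by (simp add: \<epsilon>_def)
  define g where "g = (\<lambda>x. f x + (- \<epsilon>) * (1 / (norm (x - m))\<^sup>2))"
  have far: "norm (x - m) \<ge> \<sigma> / 2" if "x \<in> cball z s" for x
    using that dist_triangle[of m z x] \<open>dist m z = \<sigma>\<close> \<open>s \<le> \<sigma> / 2\<close>
    by (simp add: dist_norm norm_minus_commute)
  \<comment> \<open>Inside \<open>cball m \<sigma>\<close> the margin \<open>c\<close> pays for the
    barrier; outside, the barrier is no larger than at \<open>z\<close>, while \<open>f\<close> is
    at least \<open>f z\<close>.\<close>
  have gz: "g z \<le> g x" if "x \<in> sphere z s" for x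
  proof (cases "x \<in> cball m \<sigma>")
    case True
    have "(\<sigma> / 2)\<^sup>2 \<le> (norm (x - m))\<^sup>2"
      using far[of x] that \<open>\<sigma> > 0\<close> by (intro power_mono) auto
    then have "\<epsilon> * (1 / (norm (x - m))\<^sup>2) \<le> \<epsilon> * (1 / (\<sigma> / 2)\<^sup>2)"
      using \<open>\<epsilon> > 0\<close> \<open>\<sigma> > 0\<close> by (intro mult_left_mono divide_left_mono mult_pos_pos) auto
    also have "\<dots> = c"
      using \<open>\<sigma> > 0\<close> by (simp add: \<epsilon>_def power_divide)
    finally have "f p \<le> g x"
      using c[of x] that True by (simp add: g_def T_def)
    moreover have "g z \<le> f p"
      using \<open>\<epsilon> > 0\<close> \<open>f z = f p\<close> by (simp add: g_def)
    ultimately show ?thesis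
      by simp
  next
    case False
    then have "\<sigma>\<^sup>2 \<le> (norm (x - m))\<^sup>2"
      using \<open>\<sigma> > 0\<close> by (intro power_mono) (auto simp: dist_norm norm_minus_commute)
    then have "\<epsilon> * (1 / (norm (x - m))\<^sup>2) \<le> \<epsilon> * (1 / \<sigma>\<^sup>2)"
      using \<open>\<epsilon> > 0\<close> \<open>\<sigma> > 0\<close> by (intro mult_left_mono divide_left_mono mult_pos_pos) auto
    moreover have "f p \<le> f x"
      using that subz by (intro min) auto
    moreover have "norm (z - m) = \<sigma>"
      using \<open>dist m z = \<sigma>\<close> by (simp add: dist_norm norm_minus_commute)
    ultimately show ?thesis
      using \<open>f z = f p\<close> by (simp add: g_def)
  qed
  have ne: "x \<noteq> m" if "x \<in> cball z s" for x
    using far[OF that] \<open>\<sigma> > 0\<close> by auto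
  have "continuous_on (cball z s) g"
    unfolding g_def
    by (intro continuous_intros continuous_on_subset[OF cont subz]) (use ne in auto)
  then obtain q0 where q0: "q0 \<in> cball z s" "\<And>x. x \<in> cball z s \<Longrightarrow> g q0 \<le> g x"
    using continuous_attains_inf[of "cball z s" g] \<open>s > 0\<close> by auto
  \<comment> \<open>If the minimum is attained on the boundary sphere, then by \<open>gz\<close> the
    centre \<open>z\<close> attains it as well.\<close>
  obtain q where q: "q \<in> ball z s" "\<And>x. x \<in> cball z s \<Longrightarrow> g q \<le> g x"
  proof (cases "q0 \<in> ball z s")
    case False
    then have "q0 \<in> sphere z s"
      using q0(1) by auto
    from gz[OF this] show ?thesis
      using q0(2) \<open>s > 0\<close> by (intro that[of z]) (auto intro: order_trans)
  qed (use q0 that in blast)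
  have "q \<in> ball p r"
    using q(1) subz ball_subset_cball by blast
  then have "has_laplacian g (0 + (- \<epsilon>) * (2 / norm (q - m) ^ 4)) q"
    unfolding g_def using q(1) ne[of q]
    by (intro has_laplacian_add has_laplacian_cmult harmonic has_laplacian_inverse_norm_sq) auto
  then have "0 \<le> 0 + (- \<epsilon>) * (2 / norm (q - m) ^ 4)"
  proof (rule has_laplacian_nonneg_if_local_min)
    show "s - dist z q > 0"
      using q(1) by simp
    fix x assume "x \<in> ball q (s - dist z q)"
    then show "g q \<le> g x"
      using dist_triangle[of z x q] by (intro q(2)) simp
  qed
  moreover have "\<epsilon> * (2 / norm (q - m) ^ 4) > 0"
    using \<open>\<epsilon> > 0\<close> ne[of q] q(1) by simp
  ultimately show False
    by simp
qed

section \<open>Coulomb potentials\<close>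

text \<open>Indexing the poles lets several of them coincide. At a pole, division by zero drops the
  singular term, so the value there has no physical meaning.\<close>

definition coulomb :: "'k set \<Rightarrow> ('k \<Rightarrow> real) \<Rightarrow> ('k \<Rightarrow> real ^ 3) \<Rightarrow> real ^ 3 \<Rightarrow> real" where
  "coulomb K c a x = (\<Sum>k\<in>K. c k / norm (x - a k))"

lemma has_laplacian_coulomb_sum:
  assumes "x \<notin> a ` K"
  shows "has_laplacian (coulomb K c a) 0 x"
proof -
  have "has_laplacian (\<lambda>y. \<Sum>k\<in>K. c k * (1 / norm (y - a k))) (\<Sum>k\<in>K. c k * 0) x"
    using assms by (intro has_laplacian_sum has_laplacian_cmult has_laplacian_coulomb) auto
  then show ?thesis
    by (simp add: coulomb_def[abs_def])
qed

lemma continuous_on_coulomb: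
  assumes "S \<inter> a ` K = {}"
  shows "continuous_on S (coulomb K c a)"
  unfolding coulomb_def[abs_def] using assms by (intro continuous_intros) auto

text \<open>
  On the line from \<open>p\<close> to a nearest pole, at distance \<open>T\<close>, the potential continues holomorphically to
  the disc \<open>|w| < T\<close>. The condition on signs only serves to exclude that coincident poles cancel.
\<close>

lemma coulomb_not_locally_constant:
  assumes "finite K" "K \<noteq> {}" and coherent: "\<And>k l. k \<in> K \<Longrightarrow> l \<in> K \<Longrightarrow> a k = a l \<Longrightarrow> c k * c l > 0"
    and p: "p \<notin> a ` K" and "r > 0" and const: "\<And>x. x \<in> ball p r \<Longrightarrow> coulomb K c a x = coulomb K c a p"
  shows False
proof -
  define k0 where "k0 = arg_min_on (\<lambda>k. dist p (a k)) K"
  have "k0 \<in> K" and nearest: "\<And>k. k \<in> K \<Longrightarrow> dist p (a k0) \<le> dist p (a k)"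
    unfolding k0_def using assms(1,2) by (auto intro: arg_min_if_finite(1) arg_min_least)
  define T where "T = dist p (a k0)"
  define u where "u = (a k0 - p) /\<^sub>R T"
  have "T > 0"
    using p \<open>k0 \<in> K\<close> by (auto simp: T_def)
  then have u: "norm u = 1" "T *\<^sub>R u = a k0 - p"
    by (auto simp: u_def T_def dist_norm norm_minus_commute)
  define \<beta> where "\<beta> k = u \<bullet> (a k - p)" for k
  define D where "D k = (norm (a k - p))\<^sup>2" for k
  \<comment> \<open>The squared distance from p + t u to \<open>a k\<close>, a real quadratic in t,
    with t made complex.\<close>
  define Q where "Q k w = w\<^sup>2 - 2 * of_real (\<beta> k) * w + of_real (D k)" for k and w :: complex
  define G where "G w = (\<Sum>k\<in>K. of_real (c k) / csqrt (Q k w))" for w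
  have D: "D k \<ge> T\<^sup>2" if "k \<in> K" for k
    using nearest[OF that] \<open>T > 0\<close> by (simp add: D_def T_def dist_norm norm_minus_commute)
  \<comment> \<open>This avoids the branch cut of \<open>csqrt\<close>: a nonpositive real value of
    \<open>Q k\<close> at w forces Re w = \<open>\<beta> k\<close>, and then |w|^2 \<ge>
    \<open>D k\<close> \<ge> T^2.\<close>
  have nonpos: "Q k w \<notin> \<real>\<^sub>\<le>\<^sub>0" if "k \<in> K" "w \<in> ball 0 T" for k w
  proof
    assume "Q k w \<in> \<real>\<^sub>\<le>\<^sub>0"
    then have Re: "Re (Q k w) \<le> 0" and Im: "Im (Q k w) = 0"
      by (auto simp: complex_nonpos_Reals_iff)
    have "(Re w)\<^sup>2 + (Im w)\<^sup>2 < T\<^sup>2"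
      using that(2) \<open>T > 0\<close> by (simp add: power_strict_mono flip: cmod_power2)
    moreover have "\<bar>\<beta> k\<bar> \<le> norm (a k - p)"
      using Cauchy_Schwarz_ineq2[of u "a k - p"] u(1) by (simp add: \<beta>_def)
    then have "(\<beta> k)\<^sup>2 \<le> D k"
      unfolding D_def by (metis abs_le_square_iff abs_norm_cancel)
    moreover have "(Re w)\<^sup>2 - (Im w)\<^sup>2 - 2 * \<beta> k * Re w + D k \<le> 0"
      using Re by (simp add: Q_def power2_eq_square)
    moreover have "Im w * (Re w - \<beta> k) = 0"
      using Im by (simp add: Q_def power2_eq_square algebra_simps)
    moreover have "(Re w - \<beta> k)\<^sup>2 \<ge> 0"
      by simp
    ultimately have "(Re w - \<beta> k)\<^sup>2 = 0" if "Im w = 0"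
      using that by (simp add: power2_diff algebra_simps)
    then have "Re w = \<beta> k"
      using \<open>Im w * (Re w - \<beta> k) = 0\<close> by auto
    then have "D k \<le> (Re w)\<^sup>2 + (Im w)\<^sup>2"
      using \<open>(Re w)\<^sup>2 - (Im w)\<^sup>2 - 2 * \<beta> k * Re w + D k \<le> 0\<close> by (simp add: power2_eq_square)
    then show False
      using D[OF that(1)] \<open>(Re w)\<^sup>2 + (Im w)\<^sup>2 < T\<^sup>2\<close> by simp
  qed
  have real: "G (of_real t) = of_real (coulomb K c a (p + t *\<^sub>R u))" for t
  proof -
    have sq: "(norm (t *\<^sub>R u - v))\<^sup>2 = t\<^sup>2 * (norm u)\<^sup>2 - 2 * (u \<bullet> v) * t + (norm v)\<^sup>2" for t v
      unfolding power2_norm_eq_inner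
      by (simp add: inner_diff_left inner_diff_right inner_commute[of v u] power2_eq_square[of t] algebra_simps)
    have "Q k (of_real t) = of_real ((norm (p + t *\<^sub>R u - a k))\<^sup>2)" for k
    proof -
      have "(norm (p + t *\<^sub>R u - a k))\<^sup>2 = (norm (t *\<^sub>R u - (a k - p)))\<^sup>2"
        by (simp add: algebra_simps)
      also have "\<dots> = t\<^sup>2 - 2 * \<beta> k * t + D k"
        using sq[of t "a k - p"] u(1) by (simp add: \<beta>_def D_def)
      finally show ?thesis
        by (simp add: Q_def)
    qed
    then show ?thesis
      by (simp add: G_def coulomb_def flip: of_real_sqrt)
  qed
  have hol: "(\<lambda>w. Q k w) holomorphic_on A" for k A
    unfolding Q_def by (intro holomorphic_intros)
  have nz: "Q k w \<noteq> 0" if "k \<in> K" "w \<in> ball 0 T" for k w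
    using nonpos[OF that] by auto
  have "G (of_real t) = G 0" if "0 \<le> t" "t < T" for t
  proof -
    \<comment> \<open>On the real points of [0, min r T) the potential keeps its value at
      \<open>p\<close>; they accumulate at 0, so the identity theorem applies.\<close>
    have "G constant_on ball 0 T"
    proof (rule analytic_continuation'[of _ _ "of_real ` {0..<min r T}" 0])
      show "G holomorphic_on ball 0 T"
        unfolding G_def by (intro holomorphic_intros hol) (use nonpos nz in auto)
      show "complex_of_real ` {0..<min r T} \<subseteq> ball 0 T"
        by auto
      show "G constant_on of_real ` {0..<min r T}"
        unfolding constant_on_def
        by (rule exI[of _ "of_real (coulomb K c a p)"]) (auto simp: real intro!: const simp: dist_norm u)
      show "0 islimpt complex_of_real ` {0..<min r T}"
        unfolding islimpt_approachable
      proof (intro allI impI)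
        fix e :: real assume "e > 0"
        then have "complex_of_real (min e (min r T) / 2) \<in> of_real ` {0..<min r T} \<and>
            complex_of_real (min e (min r T) / 2) \<noteq> 0 \<and> dist (complex_of_real (min e (min r T) / 2)) 0 < e"
          using \<open>r > 0\<close> \<open>T > 0\<close> unfolding dist_norm diff_zero norm_of_real of_real_eq_0_iff
          by (intro conjI imageI) auto
        then show "\<exists>x'\<in>complex_of_real ` {0..<min r T}. x' \<noteq> 0 \<and> dist x' 0 < e"
          by blast
      qed
    qed (use \<open>T > 0\<close> in auto)
    moreover have "of_real t \<in> ball (0::complex) T" "0 \<in> ball (0::complex) T"
      using that by auto
    ultimately show ?thesis
      unfolding constant_on_def by metis
  qed
  then have eq: "coulomb K c a (p + t *\<^sub>R u) = coulomb K c a p" if "0 \<le> t" "t < T" for t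
    using that real[of t] real[of 0] by (metis of_real_0 of_real_eq_iff scaleR_zero_left add_0_right)
  \<comment> \<open>The factor T - t isolates the poles located at \<open>a k0\<close>, whose
    distance from the moving point is exactly T - t.\<close>
  have lim_term: "((\<lambda>t. (T - t) * (c k / norm (p + t *\<^sub>R u - a k))) \<longlongrightarrow> (if a k = a k0 then c k else 0)) (at_left T)"
    if "k \<in> K" for k
  proof (cases "a k = a k0")
    case True
    have "p + t *\<^sub>R u - a k = - ((T - t) *\<^sub>R u)" for t
      using u(2) True by (simp add: algebra_simps)
    then have "norm (p + t *\<^sub>R u - a k) = \<bar>T - t\<bar>" for t
      using u(1) by simp
    then have "\<forall>\<^sub>F t in at_left T. c k = (T - t) * (c k / norm (p + t *\<^sub>R u - a k))"
      by (auto simp: eventually_at_left_field intro!: exI[of _ "T - 1"])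
    then show ?thesis
      using True by (auto intro: Lim_transform_eventually[OF tendsto_const])
  next
    case False
    then have "norm (p + T *\<^sub>R u - a k) \<noteq> 0"
      using u(2) by auto
    then have "((\<lambda>t. (T - t) * (c k / norm (p + t *\<^sub>R u - a k))) \<longlongrightarrow> (T - T) * (c k / norm (p + T *\<^sub>R u - a k))) (at_left T)"
      by (intro tendsto_intros)
    then show ?thesis
      using False by simp
  qed
  have "((\<lambda>t. \<Sum>k\<in>K. (T - t) * (c k / norm (p + t *\<^sub>R u - a k))) \<longlongrightarrow> (\<Sum>k\<in>K. if a k = a k0 then c k else 0)) (at_left T)"
    by (intro tendsto_sum lim_term)
  then have "((\<lambda>t. (T - t) * coulomb K c a (p + t *\<^sub>R u)) \<longlongrightarrow> (\<Sum>k\<in>K. if a k = a k0 then c k else 0)) (at_left T)"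
    by (simp add: coulomb_def sum_distrib_left)
  moreover have "((\<lambda>t. (T - t) * coulomb K c a (p + t *\<^sub>R u)) \<longlongrightarrow> 0) (at_left T)"
  proof (rule Lim_transform_eventually)
    have "((\<lambda>t. (T - t) * coulomb K c a p) \<longlongrightarrow> (T - T) * coulomb K c a p) (at_left T)"
      by (intro tendsto_intros)
    then show "((\<lambda>t. (T - t) * coulomb K c a p) \<longlongrightarrow> 0) (at_left T)"
      by simp
    show "\<forall>\<^sub>F t in at_left T. (T - t) * coulomb K c a p = (T - t) * coulomb K c a (p + t *\<^sub>R u)"
      using \<open>T > 0\<close> by (auto simp: eventually_at_left_field eq intro!: exI[of _ 0])
  qed
  ultimately have "(\<Sum>k\<in>K. if a k = a k0 then c k else 0) = 0"
    by (rule tendsto_unique[rotated]) simp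
  \<comment> \<open>Coincident charges agree in sign, so multiplying the vanishing sum by
    \<open>c k0\<close> gives something strictly positive.\<close>
  moreover have "(\<Sum>k\<in>K. c k0 * (if a k = a k0 then c k else 0)) > 0"
    using \<open>finite K\<close> \<open>k0 \<in> K\<close> coherent
    by (intro sum_pos2[of K k0]) (auto simp: less_imp_le)
  ultimately show False
    by (simp flip: sum_distrib_left)
qed

text \<open>The radius shrinks to \<open>s\<close> because Hopf's argument needs a ball without
  poles; it yields constancy on the ball of half that radius.\<close>

lemma coulomb_no_local_min:
  assumes "finite K" "K \<noteq> {}" and coherent: "\<And>k l. k \<in> K \<Longrightarrow> l \<in> K \<Longrightarrow> a k = a l \<Longrightarrow> c k * c l > 0"
    and p: "p \<notin> a ` K" and "r > 0"
    and min: "\<And>x. x \<in> ball p r \<Longrightarrow> coulomb K c a p \<le> coulomb K c a x"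
  shows False
proof -
  have "open (- a ` K)"
    using \<open>finite K\<close> by (intro open_Compl finite_imp_closed finite_imageI)
  then obtain e where "e > 0" "ball p e \<subseteq> - a ` K"
    using p open_contains_ball by blast
  define s where "s = min e r"
  have s: "s > 0" "ball p s \<subseteq> ball p r" "ball p s \<inter> a ` K = {}"
    using \<open>e > 0\<close> \<open>r > 0\<close> \<open>ball p e \<subseteq> - a ` K\<close> by (auto simp: s_def)
  have "coulomb K c a x = coulomb K c a p" if "x \<in> ball p (s / 2)" for x
    by (rule harmonic_local_min_locally_constant[OF s(1) _ _ _ that])
      (use s min in \<open>auto intro!: continuous_on_coulomb has_laplacian_coulomb_sum\<close>)
  then show False
    using s(1) coherent
    by (intro coulomb_not_locally_constant[OF assms(1,2) _ p, where r = "s / 2"]) auto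
qed

section \<open>Coulomb potentials at infinity\<close>

lemma coulomb_tendsto_0: "(coulomb K c a \<longlongrightarrow> 0) at_infinity"
proof -
  have "((\<lambda>x. c k / norm (x - a k)) \<longlongrightarrow> 0) at_infinity" for k
  proof (rule tendsto_divide_0[OF tendsto_const])
    have "filterlim (\<lambda>x. x + - a k) at_infinity at_infinity"
      by (rule tendsto_add_filterlim_at_infinity'[OF filterlim_ident tendsto_const])
    then have "filterlim (\<lambda>x. norm (x - a k)) at_top at_infinity"
      by (auto dest: filterlim_at_infinity_imp_norm_at_top)
    then show "filterlim (\<lambda>x. norm (x - a k)) at_infinity at_infinity"
      by (rule filterlim_at_top_imp_at_infinity)
  qed
  then have "((\<lambda>x. \<Sum>k\<in>K. c k / norm (x - a k)) \<longlongrightarrow> (\<Sum>k\<in>K. 0)) at_infinity"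
    by (intro tendsto_sum)
  then show ?thesis
    by (simp add: coulomb_def[abs_def])
qed

text \<open>The leading term of the multipole expansion: dividing all distances by t draws the poles
  together at the origin. A nonzero total charge thus decides the sign far out on every ray.\<close>

lemma coulomb_monopole:
  assumes "norm e = 1"
  shows "((\<lambda>t. t * coulomb K c a (x + t *\<^sub>R e)) \<longlongrightarrow> (\<Sum>k\<in>K. c k)) at_top"
proof (rule Lim_transform_eventually)
  have "((\<lambda>t. 1 / t) \<longlongrightarrow> (0::real)) at_top"
    by (intro tendsto_divide_0[OF tendsto_const] filterlim_at_top_imp_at_infinity filterlim_ident)
  then have "((\<lambda>t. \<Sum>k\<in>K. c k / norm (e + (1 / t) *\<^sub>R (x - a k))) \<longlongrightarrow>
      (\<Sum>k\<in>K. c k / norm (e + 0 *\<^sub>R (x - a k)))) at_top"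
    using assms by (intro tendsto_intros) auto
  then show "((\<lambda>t. \<Sum>k\<in>K. c k / norm (e + (1 / t) *\<^sub>R (x - a k))) \<longlongrightarrow> (\<Sum>k\<in>K. c k)) at_top"
    using assms by simp
  show "\<forall>\<^sub>F t in at_top. (\<Sum>k\<in>K. c k / norm (e + (1 / t) *\<^sub>R (x - a k))) = t * coulomb K c a (x + t *\<^sub>R e)"
    using eventually_gt_at_top[of 0]
  proof eventually_elim
    case (elim t)
    have "norm (x + t *\<^sub>R e - a k) = t * norm (e + (1 / t) *\<^sub>R (x - a k))" for k
    proof -
      have "x + t *\<^sub>R e - a k = t *\<^sub>R (e + (1 / t) *\<^sub>R (x - a k))"
        using elim by (simp add: algebra_simps)
      then show ?thesis
        using elim by simp
    qed
    then show ?case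
      using elim by (simp add: coulomb_def sum_distrib_left)
  qed
qed

text \<open>
  If the potential were nonnegative far out, it would be positive there, hence bounded below by a
  multiple \<open>\<kappa> / |y - a l|\<close> of the kernel; but its total charge is at most \<open>0 < \<kappa>\<close>.
  This also covers total charge exactly zero.
\<close>

lemma coulomb_negative_far:
  assumes "finite K" "l \<in> K" "c l < 0"
    and coherent: "\<And>j k. j \<in> K \<Longrightarrow> k \<in> K \<Longrightarrow> a j = a k \<Longrightarrow> c j * c k > 0"
    and charge: "(\<Sum>k\<in>K. c k) \<le> 0"
  shows "\<exists>y. norm (y - a l) > \<rho> \<and> coulomb K c a y < 0"
proof (rule ccontr)
  assume "\<not> ?thesis"
  then have nonneg: "coulomb K c a y \<ge> 0" if "norm (y - a l) > \<rho>" for y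
    using that by force
  define \<rho>\<^sub>1 where "\<rho>\<^sub>1 = \<bar>\<rho>\<bar> + 1 + (\<Sum>k\<in>K. norm (a k - a l))"
  have pole: "norm (a k - a l) < \<rho>\<^sub>1" if "k \<in> K" for k
    using member_le_sum[of k K "\<lambda>k. norm (a k - a l)"] that \<open>finite K\<close> by (simp add: \<rho>\<^sub>1_def)
  then have no_pole: "y \<notin> a ` K" if "norm (y - a l) \<ge> \<rho>\<^sub>1" for y
    using that by force
  have "\<rho>\<^sub>1 > 0" "\<rho>\<^sub>1 > \<rho>"
    using sum_nonneg[of K "\<lambda>k. norm (a k - a l)"] by (auto simp: \<rho>\<^sub>1_def)
  \<comment> \<open>A zero would be a local minimum of a nonnegative potential.\<close>
  have pos: "coulomb K c a y > 0" if y: "norm (y - a l) \<ge> \<rho>\<^sub>1" for y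
  proof (rule ccontr)
    assume "\<not> coulomb K c a y > 0"
    moreover have "coulomb K c a y \<ge> 0"
      using y \<open>\<rho>\<^sub>1 > \<rho>\<close> by (intro nonneg) simp
    ultimately have "coulomb K c a y = 0"
      by simp
    have "coulomb K c a y \<le> coulomb K c a x" if "x \<in> ball y (\<rho>\<^sub>1 - \<rho>)" for x
      using \<open>coulomb K c a y = 0\<close> that y dist_triangle[of y "a l" x]
      by (auto intro!: nonneg simp: dist_norm norm_minus_commute)
    then show False
      using coulomb_no_local_min[of K a c y "\<rho>\<^sub>1 - \<rho>"] assms no_pole[OF y] \<open>\<rho>\<^sub>1 > \<rho>\<close> by auto
  qed
  obtain \<kappa> where "\<kappa> > 0" and \<kappa>: "\<And>y. norm (y - a l) = \<rho>\<^sub>1 \<Longrightarrow> \<kappa> / \<rho>\<^sub>1 \<le> coulomb K c a y"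
  proof -
    have "sphere (a l) \<rho>\<^sub>1 \<inter> a ` K = {}"
      using no_pole by (force simp: dist_norm norm_minus_commute)
    then obtain x0 where x0: "x0 \<in> sphere (a l) \<rho>\<^sub>1"
      "\<And>y. y \<in> sphere (a l) \<rho>\<^sub>1 \<Longrightarrow> coulomb K c a x0 \<le> coulomb K c a y"
      using continuous_attains_inf[of "sphere (a l) \<rho>\<^sub>1" "coulomb K c a"] \<open>\<rho>\<^sub>1 > 0\<close>
      by (auto simp: continuous_on_coulomb)
    show ?thesis
    proof (rule that[of "coulomb K c a x0 * \<rho>\<^sub>1"])
      show "coulomb K c a x0 * \<rho>\<^sub>1 > 0"
        using pos[of x0] x0(1) \<open>\<rho>\<^sub>1 > 0\<close> by (simp add: dist_norm norm_minus_commute)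
    qed (use x0(2) \<open>\<rho>\<^sub>1 > 0\<close> in \<open>simp add: dist_norm norm_minus_commute\<close>)
  qed
  \<comment> \<open>The charge at \<open>l\<close> is negative and only becomes more so; coincident
    charges therefore still agree in sign, and the total charge becomes strictly negative.\<close>
  define c' where "c' = c(l := c l - \<kappa>)"
  have sum_c': "(\<Sum>k\<in>K. c' k * g k) = (\<Sum>k\<in>K. c k * g k) - \<kappa> * g l" for g
    using \<open>finite K\<close> \<open>l \<in> K\<close> by (simp add: c'_def sum.remove[of K l] algebra_simps)
  have coulomb_c': "coulomb K c' a y = coulomb K c a y - \<kappa> / norm (y - a l)" for y
    using sum_c'[of "\<lambda>k. 1 / norm (y - a k)"] by (simp add: coulomb_def)
  have coherent': "c' j * c' k > 0" if "j \<in> K" "k \<in> K" "a j = a k" for j k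
    using coherent[OF that] coherent[of l k] coherent[of j l] that \<open>l \<in> K\<close> \<open>c l < 0\<close> \<open>\<kappa> > 0\<close>
    by (auto simp: c'_def zero_less_mult_iff)
  obtain e :: "real ^ 3" where "norm e = 1"
    using vector_choose_size[of 1] by auto
  have "(\<Sum>k\<in>K. c' k) < 0"
    using sum_c'[of "\<lambda>_. 1"] charge \<open>\<kappa> > 0\<close> by simp
  then have "\<forall>\<^sub>F t in at_top. t * coulomb K c' a (a l + t *\<^sub>R e) < 0 \<and> t > \<rho>\<^sub>1"
    by (intro eventually_conj eventually_gt_at_top order_tendstoD(2)[OF coulomb_monopole[OF \<open>norm e = 1\<close>]])
  then obtain t where "t > \<rho>\<^sub>1" "t * coulomb K c' a (a l + t *\<^sub>R e) < 0"
    using eventually_happens'[OF trivial_limit_at_top_linorder] by blast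
  define y0 where "y0 = a l + t *\<^sub>R e"
  have "norm (y0 - a l) > \<rho>\<^sub>1" "coulomb K c' a y0 < 0"
    using \<open>t > \<rho>\<^sub>1\<close> \<open>norm e = 1\<close> \<open>\<rho>\<^sub>1 > 0\<close> \<open>t * coulomb K c' a (a l + t *\<^sub>R e) < 0\<close>
    by (auto simp: y0_def mult_less_0_iff)
  have "\<forall>\<^sub>F y in at_infinity. coulomb K c' a y0 < coulomb K c' a y"
    by (rule order_tendstoD(1)[OF coulomb_tendsto_0 \<open>coulomb K c' a y0 < 0\<close>])
  then obtain b where b: "\<And>y. norm y \<ge> b \<Longrightarrow> coulomb K c' a y0 < coulomb K c' a y"
    by (auto simp: eventually_at_infinity)
  define \<rho>\<^sub>2 where "\<rho>\<^sub>2 = max (norm (y0 - a l)) (b + norm (a l))"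
  have outer: "coulomb K c' a y0 < coulomb K c' a y" if "norm (y - a l) = \<rho>\<^sub>2" for y
    using that norm_triangle_ineq4[of y "a l"] by (intro b) (simp add: \<rho>\<^sub>2_def)
  \<comment> \<open>On the inner sphere \<open>\<kappa>\<close> keeps the new potential nonnegative;
    on the outer one it exceeds its negative value at \<open>y0\<close>. A minimum over this shell
    is therefore interior.\<close>
  define A where "A = cball (a l) \<rho>\<^sub>2 - ball (a l) \<rho>\<^sub>1"
  have A: "y \<in> A \<longleftrightarrow> \<rho>\<^sub>1 \<le> norm (y - a l) \<and> norm (y - a l) \<le> \<rho>\<^sub>2" for y
    by (auto simp: A_def dist_norm norm_minus_commute)
  have "compact A"
    unfolding A_def by (intro compact_diff) auto
  moreover have "y0 \<in> A"
    using \<open>norm (y0 - a l) > \<rho>\<^sub>1\<close> by (simp add: A \<rho>\<^sub>2_def)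
  moreover have "continuous_on A (coulomb K c' a)"
    by (intro continuous_on_coulomb) (use A no_pole in blast)
  ultimately obtain q where "q \<in> A" and q: "\<And>y. y \<in> A \<Longrightarrow> coulomb K c' a q \<le> coulomb K c' a y"
    using continuous_attains_inf[of A "coulomb K c' a"] by blast
  have "coulomb K c' a q < 0"
    using q[OF \<open>y0 \<in> A\<close>] \<open>coulomb K c' a y0 < 0\<close> by simp
  then have "norm (q - a l) \<noteq> \<rho>\<^sub>1"
    using \<kappa>[of q] by (auto simp: coulomb_c')
  moreover have "norm (q - a l) \<noteq> \<rho>\<^sub>2"
    using outer[of q] q[OF \<open>y0 \<in> A\<close>] by auto
  ultimately have strict: "norm (q - a l) > \<rho>\<^sub>1" "norm (q - a l) < \<rho>\<^sub>2"
    using \<open>q \<in> A\<close> by (auto simp: A)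
  define s where "s = min (norm (q - a l) - \<rho>\<^sub>1) (\<rho>\<^sub>2 - norm (q - a l))"
  have "coulomb K c' a q \<le> coulomb K c' a y" if "y \<in> ball q s" for y
  proof (rule q)
    show "y \<in> A"
      using that norm_triangle_ineq2[of "q - a l" "y - a l"] norm_triangle_ineq2[of "y - a l" "q - a l"]
      by (auto simp: A s_def dist_norm norm_minus_commute)
  qed
  then show False
    using coulomb_no_local_min[of K a c' q s] assms(1,2) coherent' no_pole[of q] strict
    by (auto simp: s_def)
qed

section \<open>Energies\<close>

text \<open>An arbitrary index set, so that any electron, not just the last, can be split
  off.\<close>

definition energy ::
    "nat \<Rightarrow> (nat \<Rightarrow> real ^ 3) \<Rightarrow> (nat \<Rightarrow> real) \<Rightarrow> nat set \<Rightarrow> (nat \<Rightarrow> real ^ 3) \<Rightarrow> ereal" where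
  "energy M R Z I x =
     (\<Sum>i\<in>I. ext_potential M R Z (x i)) +
     (\<Sum>(i, j) \<in> {(i, j). i \<in> I \<and> j \<in> I \<and> i < j}. 1 / ereal (norm (x i - x j)))"

lemma total_potential_eq_energy: "total_potential M R Z N x = energy M R Z {1..N} x"
proof -
  have "{(i, j). 1 \<le> i \<and> i < j \<and> j \<le> N} = {(i, j). i \<in> {1..N} \<and> j \<in> {1..N} \<and> i < j}"
    by auto
  then show ?thesis
    by (simp add: total_potential_def energy_def)
qed

lemma energy_empty [simp]: "energy M R Z {} x = 0"
  by (simp add: energy_def)

lemma energy_insert:
  assumes "finite I" "k \<notin> I"
  shows "energy M R Z (insert k I) x =
    energy M R Z I x + (ext_potential M R Z (x k) + (\<Sum>j\<in>I. 1 / ereal (norm (x k - x j))))"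
proof -
  let ?P = "{(i, j). i \<in> I \<and> j \<in> I \<and> i < j}"
  \<comment> \<open>The pair of \<open>j\<close> and \<open>k\<close> in increasing order, since
    \<open>k\<close> may fall anywhere among the indices.\<close>
  define f where "f j = (if j < k then (j, k) else (k, j))" for j
  have "finite ?P"
    by (rule finite_subset[of _ "I \<times> I"]) (use \<open>finite I\<close> in auto)
  have "{(i, j). i \<in> insert k I \<and> j \<in> insert k I \<and> i < j} = ?P \<union> f ` I"
    using \<open>k \<notin> I\<close> by (auto simp: f_def image_iff) (metis linorder_neqE_nat)+
  moreover have "?P \<inter> f ` I = {}"
    using \<open>k \<notin> I\<close> by (auto simp: f_def split: if_splits)
  moreover have "inj_on f I"
    by (auto simp: f_def inj_on_def split: if_splits)
  moreover have "(case f j of (i, j) \<Rightarrow> 1 / ereal (norm (x i - x j))) = 1 / ereal (norm (x k - x j))" for j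
    by (simp add: f_def norm_minus_commute)
  ultimately have "(\<Sum>(i, j) \<in> {(i, j). i \<in> insert k I \<and> j \<in> insert k I \<and> i < j}. 1 / ereal (norm (x i - x j))) =
      (\<Sum>(i, j) \<in> ?P. 1 / ereal (norm (x i - x j))) + (\<Sum>j\<in>I. 1 / ereal (norm (x k - x j)))"
    using \<open>finite ?P\<close> \<open>finite I\<close> by (simp add: sum.union_disjoint sum.reindex)
  then show ?thesis
    using assms by (simp add: energy_def add_ac)
qed

lemma energy_cong:
  assumes "\<And>i. i \<in> I \<Longrightarrow> x i = y i"
  shows "energy M R Z I x = energy M R Z I y"
  unfolding energy_def using assms by (intro arg_cong2[of _ _ _ _ "(+)"] sum.cong) auto

text \<open>Electrons are interchangeable although pairs are listed in index order, since
  \<open>energy_insert\<close> is insensitive to that order. This permits relabelling a remote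
  electron as the last one.\<close>

lemma energy_reindex:
  assumes "finite I" "inj_on f I"
  shows "energy M R Z (f ` I) x = energy M R Z I (x \<circ> f)"
  using assms
proof (induction I)
  case (insert k I)
  then have "f k \<notin> f ` I" "inj_on f I"
    by auto
  with insert show ?case
    by (simp add: energy_insert sum.reindex)
qed simp

text \<open>The sum type merges nuclei and electrons into one family of poles; signs are those felt
  by an electron, attraction being negative.\<close>

definition charges :: "(nat \<Rightarrow> real) \<Rightarrow> nat + nat \<Rightarrow> real" where
  "charges Z = case_sum (\<lambda>\<alpha>. - Z \<alpha>) (\<lambda>_. 1)"

text \<open>Real-valued, so that harmonicity applies; it is matched with the extended-real
  interaction only away from the nuclei and the electrons in \<open>J\<close>.\<close>

definition felt_potential ::
    "nat \<Rightarrow> (nat \<Rightarrow> real ^ 3) \<Rightarrow> (nat \<Rightarrow> real) \<Rightarrow> nat set \<Rightarrow> (nat \<Rightarrow> real ^ 3) \<Rightarrow> real ^ 3 \<Rightarrow> real" where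
  "felt_potential M R Z J x = coulomb ({1..M} <+> J) (charges Z) (case_sum R x)"

lemma ext_potential_real:
  assumes "y \<notin> R ` {1..M}"
  shows "ext_potential M R Z y = ereal (coulomb {1..M} (\<lambda>\<alpha>. - Z \<alpha>) R y)"
proof -
  have "ereal (- Z \<alpha>) / ereal (norm (y - R \<alpha>)) = ereal (- Z \<alpha> / norm (y - R \<alpha>))" if "\<alpha> \<in> {1..M}" for \<alpha>
    using assms that by (subst ereal_divide) auto
  then show ?thesis
    unfolding ext_potential_def coulomb_def sum_ereal[symmetric] by (intro sum.cong) auto
qed

lemma interaction_eq_felt_potential:
  assumes "finite J" "y \<notin> R ` {1..M}" "y \<notin> x ` J"
  shows "ext_potential M R Z y + (\<Sum>j\<in>J. 1 / ereal (norm (y - x j))) = ereal (felt_potential M R Z J x y)"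
proof -
  have "1 / ereal (norm (y - x j)) = ereal (1 / norm (y - x j))" if "j \<in> J" for j
    using assms(3) that by (subst one_ereal_def, subst ereal_divide) auto
  then have "(\<Sum>j\<in>J. 1 / ereal (norm (y - x j))) = ereal (\<Sum>j\<in>J. 1 / norm (y - x j))"
    unfolding sum_ereal[symmetric] by (intro sum.cong) auto
  with ext_potential_real[OF assms(2)] \<open>finite J\<close> show ?thesis
    by (simp add: felt_potential_def coulomb_def charges_def sum.Plus)
qed

lemma energy_real:
  assumes "finite I" "inj_on x I" "\<And>i. i \<in> I \<Longrightarrow> x i \<notin> R ` {1..M}"
  shows "\<exists>e. energy M R Z I x = ereal e"
  using assms
proof (induction I)
  case (insert k I)
  then obtain e where "energy M R Z I x = ereal e"
    by auto
  with insert show ?case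
    by (subst energy_insert) (auto simp: interaction_eq_felt_potential)
qed (auto intro: exI[of _ 0] simp: zero_ereal_def)

text \<open>Coincident poles are of one kind, since no electron sits on a nucleus.\<close>

lemma charges_coherent:
  assumes "\<And>\<alpha>. \<alpha> \<in> {1..M} \<Longrightarrow> Z \<alpha> > 0" "\<And>j. j \<in> J \<Longrightarrow> x j \<notin> R ` {1..M}"
    and "k \<in> {1..M} <+> J" "l \<in> {1..M} <+> J" "case_sum R x k = case_sum R x l"
  shows "charges Z k * charges Z l > 0"
proof -
  have "R \<alpha> \<noteq> x j" if "\<alpha> \<in> {1..M}" "j \<in> J" for \<alpha> j
    using assms(2)[OF that(2)] that(1) by (metis image_eqI)
  with assms show ?thesis
    by (cases k; cases l) (force simp: charges_def intro: mult_neg_neg)+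
qed

lemma admissible_not_nucleus:
  assumes "x \<in> admissible M R d N" "d > 0" "i \<in> {1..N}"
  shows "x i \<notin> R ` {1..M}"
  using assms by (force simp: admissible_def)

text \<open>Ensures that minimizers have finite energy, which rules out coincident
  electrons.\<close>

lemma admissible_potential_finite:
  assumes "d > 0"
  shows "\<exists>x\<in>admissible M R d N. total_potential M R Z N x < \<infinity>"
proof -
  obtain e :: "real ^ 3" where "norm e = 1"
    using vector_choose_size[of 1] by auto
  \<comment> \<open>Points at least this far from the origin have distance at least \<open>d\<close>
    from every nucleus; the electrons are then lined up on a ray at distinct points.\<close>
  define C where "C = d + (\<Sum>\<alpha>=1..M. norm (R \<alpha>))"
  define x where "x = (\<lambda>i. if i \<in> {1..N} then (C + real i) *\<^sub>R e else undefined)"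
  have adm: "x \<in> admissible M R d N"
    unfolding admissible_def
  proof (safe intro!: PiE_I)
    fix i \<alpha> assume "i \<in> {1..N}" "\<alpha> \<in> {1..M}"
    have "norm (R \<alpha>) \<le> (\<Sum>\<alpha>=1..M. norm (R \<alpha>))"
      using \<open>\<alpha> \<in> {1..M}\<close> by (intro member_le_sum) auto
    moreover have "(\<Sum>\<alpha>=1..M. norm (R \<alpha>)) \<ge> 0"
      by (intro sum_nonneg) auto
    moreover have "norm (x i) = \<bar>C + real i\<bar>"
      using \<open>i \<in> {1..N}\<close> \<open>norm e = 1\<close> by (simp add: x_def)
    ultimately show "d \<le> norm (x i - R \<alpha>)"
      using \<open>d > 0\<close> norm_triangle_ineq2[of "x i" "R \<alpha>"] by (simp add: C_def)
  qed (auto simp: x_def)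
  have "e \<noteq> 0"
    using \<open>norm e = 1\<close> by auto
  then have "inj_on x {1..N}"
    by (auto simp: inj_on_def x_def)
  then have "total_potential M R Z N x < \<infinity>"
    using energy_real[of "{1..N}" x R M Z] admissible_not_nucleus[OF adm \<open>d > 0\<close>]
    by (auto simp: total_potential_eq_energy)
  with adm show ?thesis
    by blast
qed

section \<open>Minimizers\<close>

lemma minimizer_inj_on:
  assumes "d > 0" and min: "is_arg_min (total_potential M R Z N) (\<lambda>x. x \<in> admissible M R d N) x"
  shows "inj_on x {1..N}"
proof -
  have finite: "total_potential M R Z N x \<noteq> \<infinity>"
    using admissible_potential_finite[OF \<open>d > 0\<close>, of M R N Z] min
    by (auto simp: is_arg_min_def)
  show ?thesis
  proof (rule linorder_inj_onI')
    fix i j assume "i \<in> {1..N}" "j \<in> {1..N}" "i < j"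
    then show "x i \<noteq> x j"
      using total_potential_coincident[of i j N x M R Z] finite by auto
  qed
qed

lemma minimizer_on_spheres:
  assumes "M \<ge> 1" and Z: "\<And>\<alpha>. \<alpha> \<in> {1..M} \<Longrightarrow> Z \<alpha> > 0" and "d > 0"
    and min: "is_arg_min (total_potential M R Z N) (\<lambda>x. x \<in> admissible M R d N) x"
    and i: "i \<in> {1..N}"
  shows "x i \<in> (\<Union>\<alpha>\<in>{1..M}. sphere (R \<alpha>) d)"
proof (rule ccontr)
  assume contra: "x i \<notin> (\<Union>\<alpha>\<in>{1..M}. sphere (R \<alpha>) d)"
  let ?J = "{1..N} - {i}"
  have adm: "x \<in> admissible M R d N"
    using min by (simp add: is_arg_min_def)
  note inj = minimizer_inj_on[OF \<open>d > 0\<close> min]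
  note off = admissible_not_nucleus[OF adm \<open>d > 0\<close>]
  obtain e where e: "energy M R Z ?J x = ereal e"
    using energy_real[of ?J x R M Z] off inj by (auto intro: inj_on_subset)
  have energy: "total_potential M R Z N (x(i := y)) = ereal (e + felt_potential M R Z ?J x y)"
    if "y \<notin> R ` {1..M}" "y \<notin> x ` ?J" for y
  proof -
    have "total_potential M R Z N (x(i := y)) = energy M R Z (insert i ?J) (x(i := y))"
      using i by (simp add: total_potential_eq_energy insert_absorb)
    also have "\<dots> = energy M R Z ?J (x(i := y)) +
        (ext_potential M R Z y + (\<Sum>j\<in>?J. 1 / ereal (norm (y - (x(i := y)) j))))"
      by (subst energy_insert) auto
    also have "energy M R Z ?J (x(i := y)) = ereal e"
      unfolding e[symmetric] by (rule energy_cong) auto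
    also have "(\<Sum>j\<in>?J. 1 / ereal (norm (y - (x(i := y)) j))) = (\<Sum>j\<in>?J. 1 / ereal (norm (y - x j)))"
      by (intro sum.cong) auto
    finally show ?thesis
      using that by (simp add: interaction_eq_felt_potential del: fun_upd_apply)
  qed
  \<comment> \<open>Off the spheres the constraint is strict, hence open; collisions are removed as
    well, so that \<open>energy\<close> applies at every point of \<open>U\<close>.\<close>
  define U where "U = (\<Inter>\<alpha>\<in>{1..M}. - cball (R \<alpha>) d) \<inter> - (x ` ?J)"
  have outside: "d < dist (R \<alpha>) (x i)" if "\<alpha> \<in> {1..M}" for \<alpha>
  proof -
    have "d \<le> dist (R \<alpha>) (x i)" "d \<noteq> dist (R \<alpha>) (x i)"
      using adm contra i that by (auto simp: admissible_def dist_norm norm_minus_commute)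
    then show ?thesis
      by simp
  qed
  have "open U"
    unfolding U_def by (intro open_Int open_INT open_Compl finite_imp_closed) auto
  moreover have "x i \<in> U"
    unfolding U_def
  proof (intro IntI INT_I ComplI)
    assume "x i \<in> x ` ?J"
    then obtain j where "j \<in> {1..N}" "j \<noteq> i" "x i = x j"
      by blast
    then show False
      using inj i by (auto dest: inj_onD)
  next
    fix \<alpha> assume "\<alpha> \<in> {1..M}" "x i \<in> cball (R \<alpha>) d"
    with outside[of \<alpha>] show False
      by simp
  qed
  ultimately obtain r where "r > 0" "ball (x i) r \<subseteq> U"
    using open_contains_ball by blast
  have U: "y \<notin> R ` {1..M}" "y \<notin> x ` ?J" "x(i := y) \<in> admissible M R d N" if "y \<in> U" for y
  proof -
    have gt: "d < norm (y - R \<alpha>)" if "\<alpha> \<in> {1..M}" for \<alpha>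
      using \<open>y \<in> U\<close> that by (auto simp: U_def dist_norm norm_minus_commute not_le)
    then show "y \<notin> R ` {1..M}"
      using \<open>d > 0\<close> by fastforce
    show "x(i := y) \<in> admissible M R d N"
      using adm i gt[THEN less_imp_le] by (auto simp: admissible_def PiE_iff extensional_def)
    show "y \<notin> x ` ?J"
      using \<open>y \<in> U\<close> by (simp add: U_def)
  qed
  have "felt_potential M R Z ?J x (x i) \<le> felt_potential M R Z ?J x y" if "y \<in> ball (x i) r" for y
  proof -
    have "y \<in> U"
      using that \<open>ball (x i) r \<subseteq> U\<close> by blast
    have "\<not> total_potential M R Z N (x(i := y)) < total_potential M R Z N (x(i := x i))"
      using min U(3)[OF \<open>y \<in> U\<close>] by (simp add: is_arg_min_def)
    then show ?thesis
      using energy[of y] energy[of "x i"] U[OF \<open>y \<in> U\<close>] U[OF \<open>x i \<in> U\<close>] by simp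
  qed
  note min_felt = this[unfolded felt_potential_def]
  show False
  proof (rule coulomb_no_local_min[OF _ _ _ _ \<open>r > 0\<close> min_felt])
    show "{1..M} <+> ?J \<noteq> {}"
      using \<open>M \<ge> 1\<close> by auto
    show "x i \<notin> case_sum R x ` ({1..M} <+> ?J)"
      using U[OF \<open>x i \<in> U\<close>] by (auto simp: image_iff)
    fix k l assume "k \<in> {1..M} <+> ?J" "l \<in> {1..M} <+> ?J" "case_sum R x k = case_sum R x l"
    with Z off show "charges Z k * charges Z l > 0"
      by (intro charges_coherent) auto
  qed auto
qed

section \<open>Compactness and existence of minimizers\<close>

lemma compact_PiE:
  fixes S :: "'a \<Rightarrow> 'b::topological_space set"
  assumes "\<And>i. i \<in> I \<Longrightarrow> compact (S i)"
  shows "compact (Pi\<^sub>E I S)"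
proof -
  \<comment> \<open>Coordinates outside \<open>I\<close> range over the compact singleton
    \<open>{undefined}\<close>, so Tychonoff's theorem applies to the product over all
    indices.\<close>
  have "Pi\<^sub>E I S = Pi\<^sub>E UNIV (\<lambda>i. if i \<in> I then S i else {undefined})"
    by (auto simp: PiE_iff extensional_def split: if_splits)
  moreover have "compactin euclidean (Pi\<^sub>E UNIV (\<lambda>i. if i \<in> I then S i else {undefined}))"
    unfolding euclidean_product_topology[symmetric] compactin_PiE using assms by auto
  ultimately show ?thesis
    by simp
qed

text \<open>Collisions, where the value is infinite, are included. Repulsion is treated in
  \<open>ennreal\<close>, where inversion is continuous at 0; attraction is real on admissible
  tuples, so \<infinity> - \<infinity> does not occur.\<close>

lemma continuous_on_total_potential:
  assumes "d > 0"
  shows "continuous_on (admissible M R d N) (total_potential M R Z N)"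
proof -
  let ?A = "admissible M R d N"
  let ?P = "{(i, j). 1 \<le> i \<and> i < j \<and> j \<le> N}"
  define V where "V x = (\<Sum>i=1..N. coulomb {1..M} (\<lambda>\<alpha>. - Z \<alpha>) R (x i))" for x
  define W where "W x = (\<Sum>(i, j)\<in>?P. inverse (ennreal (norm (x i - x j))))" for x :: "nat \<Rightarrow> real ^ 3"
  have coord: "continuous_on S (\<lambda>x. x i :: real ^ 3)" for S and i :: nat
    by (rule continuous_on_subset[OF continuous_on_product_coordinates]) simp
  have "total_potential M R Z N x = ereal (V x) + enn2ereal (W x)" if "x \<in> ?A" for x
  proof -
    have "(\<Sum>i=1..N. ext_potential M R Z (x i)) = ereal (V x)"
      unfolding V_def sum_ereal[symmetric]
      by (intro sum.cong refl ext_potential_real admissible_not_nucleus[OF that assms])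
    moreover have "1 / ereal (norm y) = enn2ereal (inverse (ennreal (norm y)))" for y :: "real ^ 3"
      by (simp add: inverse_ennreal.rep_eq divide_ereal_def)
    then have "(\<Sum>(i, j)\<in>?P. 1 / ereal (norm (x i - x j))) = enn2ereal (W x)"
      by (simp add: W_def case_prod_unfold flip: sum_enn2ereal)
    ultimately show ?thesis
      by (simp add: total_potential_def)
  qed
  moreover have "continuous_on ?A (\<lambda>x. ereal (V x) + enn2ereal (W x))"
  proof -
    have "continuous_on ?A V"
      unfolding V_def coulomb_def
      by (intro continuous_intros coord) (use admissible_not_nucleus[OF _ assms] in fastforce)
    moreover have "continuous_on ?A W"
      unfolding W_def case_prod_unfold
      by (intro continuous_on_sum continuous_on_inverse_ennreal continuous_on_ennreal continuous_intros coord)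
    then have "continuous_on ?A (\<lambda>x. enn2ereal (W x))"
      by (rule continuous_on_compose2[OF continuous_on_enn2ereal]) simp
    ultimately show ?thesis
      unfolding continuous_on_def by (auto intro!: tendsto_add_ereal_general2)
  qed
  ultimately show ?thesis
    by (subst continuous_on_cong[OF refl]) auto
qed

text \<open>Bounded admissible positions form a compact set because the excluded balls are open;
  \<open>u\<close> makes the truncated set nonempty.\<close>

lemma truncated_minimizer:
  assumes "d > 0" "u \<in> admissible M R d N" "\<And>i. i \<in> {1..N} \<Longrightarrow> norm (u i) \<le> \<rho>"
  obtains x where "x \<in> admissible M R d N"
    "\<And>w. w \<in> admissible M R d N \<Longrightarrow> (\<And>i. i \<in> {1..N} \<Longrightarrow> norm (w i) \<le> \<rho>) \<Longrightarrow>
      total_potential M R Z N x \<le> total_potential M R Z N w"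
proof -
  define B where "B = cball 0 \<rho> - (\<Union>\<alpha>\<in>{1..M}. ball (R \<alpha>) d)"
  define K where "K = (\<Pi>\<^sub>E i\<in>{1..N}. B)"
  have "compact K"
    unfolding K_def B_def by (intro compact_PiE compact_diff) auto
  moreover have K: "w \<in> K \<longleftrightarrow> w \<in> admissible M R d N \<and> (\<forall>i\<in>{1..N}. norm (w i) \<le> \<rho>)" for w
    by (auto simp: K_def B_def admissible_def PiE_iff dist_norm norm_minus_commute not_less)
  moreover from K have "continuous_on K (total_potential M R Z N)"
    by (intro continuous_on_subset[OF continuous_on_total_potential[OF \<open>d > 0\<close>]]) blast
  moreover have "u \<in> K"
    using assms K by blast
  ultimately show ?thesis
    using continuous_attains_inf[of K "total_potential M R Z N"] that by (metis empty_iff)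
qed

text \<open>
  It suffices that some configuration of \<open>n + 1\<close> electrons lies below the ground state energy of
  \<open>n\<close> electrons: a configuration with one electron far away costs almost at least the latter.
\<close>

lemma minimizer_Suc:
  assumes "d > 0"
    and min: "is_arg_min (total_potential M R Z n) (\<lambda>x. x \<in> admissible M R d n) x"
    and u: "u \<in> admissible M R d (Suc n)"
    and less: "total_potential M R Z (Suc n) u < total_potential M R Z n x"
  shows "\<exists>x. is_arg_min (total_potential M R Z (Suc n)) (\<lambda>x. x \<in> admissible M R d (Suc n)) x"
proof -
  have x: "x \<in> admissible M R d n"
    using min by (simp add: is_arg_min_def)
  obtain E where E: "total_potential M R Z n x = ereal E"
    using energy_real[of "{1..n}" x R M Z] minimizer_inj_on[OF \<open>d > 0\<close> min] admissible_not_nucleus[OF x \<open>d > 0\<close>]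
    by (auto simp: total_potential_eq_energy)
  \<comment> \<open>The choice of \<open>b\<close> below makes the nuclear attraction on an electron
    beyond it too weak to bridge the gap E - E'.\<close>
  obtain E' where "E' < E" and E': "total_potential M R Z (Suc n) u \<le> ereal E'"
    using less ereal_dense2[of "total_potential M R Z (Suc n) u" "ereal E"] by (auto simp: E)
  have "\<forall>\<^sub>F y in at_infinity. E' - E < coulomb {1..M} (\<lambda>\<alpha>. - Z \<alpha>) R y"
    by (rule order_tendstoD(1)[OF coulomb_tendsto_0]) (use \<open>E' < E\<close> in simp)
  then obtain b where b: "\<And>y. norm y \<ge> b \<Longrightarrow> E' - E < coulomb {1..M} (\<lambda>\<alpha>. - Z \<alpha>) R y"
    by (auto simp: eventually_at_infinity)
  define \<rho> where "\<rho> = max b (\<Sum>i=1..Suc n. norm (u i))"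
  have "norm (u i) \<le> \<rho>" if "i \<in> {1..Suc n}" for i
    using member_le_sum[of i "{1..Suc n}" "\<lambda>i. norm (u i)"] that by (simp add: \<rho>_def)
  then obtain z where z: "z \<in> admissible M R d (Suc n)"
    "\<And>w. w \<in> admissible M R d (Suc n) \<Longrightarrow> (\<And>i. i \<in> {1..Suc n} \<Longrightarrow> norm (w i) \<le> \<rho>) \<Longrightarrow>
      total_potential M R Z (Suc n) z \<le> total_potential M R Z (Suc n) w"
    and zu: "total_potential M R Z (Suc n) z \<le> total_potential M R Z (Suc n) u"
    using truncated_minimizer[OF \<open>d > 0\<close> u, of \<rho> Z] u by metis
  have "total_potential M R Z (Suc n) z \<le> total_potential M R Z (Suc n) w"
    if w: "w \<in> admissible M R d (Suc n)" for w
  proof (cases "\<forall>i\<in>{1..Suc n}. norm (w i) \<le> \<rho>")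
    case False
    then obtain k where k: "k \<in> {1..Suc n}" "norm (w k) > \<rho>"
      by force
    \<comment> \<open>Swaps the remote electron into the last place, where it can be split
      off.\<close>
    define v where "v = w \<circ> Transposition.transpose k (Suc n)"
    have img: "Transposition.transpose k (Suc n) ` {1..Suc n} = {1..Suc n}"
      using k(1) by (intro transpose_image_eq) auto
    then have v_adm: "norm (v i - R \<alpha>) \<ge> d" if "i \<in> {1..Suc n}" "\<alpha> \<in> {1..M}" for i \<alpha>
      using w that by (force simp: admissible_def v_def)
    have "restrict v {1..n} \<in> admissible M R d n"
      using v_adm by (auto simp: admissible_def)
    then have "ereal E \<le> total_potential M R Z n (restrict v {1..n})"
      using min E by (force simp: is_arg_min_def not_less)
    also have "\<dots> = energy M R Z {1..n} v"
      unfolding total_potential_eq_energy by (rule energy_cong) simp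
    finally have "ereal E \<le> energy M R Z {1..n} v" .
    moreover have "ereal (E' - E) \<le> ext_potential M R Z (v (Suc n))"
    proof -
      have "v (Suc n) \<notin> R ` {1..M}"
        using v_adm[of "Suc n"] \<open>d > 0\<close> by force
      moreover have "norm (v (Suc n)) \<ge> b"
        using k(2) by (simp add: v_def \<rho>_def)
      ultimately show ?thesis
        using b[of "v (Suc n)"] by (simp add: ext_potential_real)
    qed
    moreover have "0 \<le> (\<Sum>j\<in>{1..n}. 1 / ereal (norm (v (Suc n) - v j)))"
      by (intro sum_nonneg) (simp add: divide_ereal_def)
    \<comment> \<open>The left-hand side is E': at least E for the other n electrons, E' - E for the
      attraction of the remote one, and 0 for its repulsion.\<close>
    ultimately have "ereal E + (ereal (E' - E) + 0) \<le>
        energy M R Z {1..n} v + (ext_potential M R Z (v (Suc n)) + (\<Sum>j\<in>{1..n}. 1 / ereal (norm (v (Suc n) - v j))))"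
      by (intro add_mono)
    also have "\<dots> = energy M R Z (insert (Suc n) {1..n}) v"
      by (subst energy_insert) auto
    also have "insert (Suc n) {1..n} = {1..Suc n}"
      by auto
    also have "energy M R Z {1..Suc n} v = total_potential M R Z (Suc n) w"
      using energy_reindex[of "{1..Suc n}" "Transposition.transpose k (Suc n)" M R Z w] img
      by (simp add: v_def total_potential_eq_energy inj_on_transpose)
    finally show ?thesis
      using zu E' by (simp add: zero_ereal_def)
  qed (use z w in blast)
  with z(1) show ?thesis
    by (force simp: is_arg_min_def not_less)
qed

lemma minimizer_exists:
  assumes "M \<ge> 1" and Z: "\<And>\<alpha>. \<alpha> \<in> {1..M} \<Longrightarrow> Z \<alpha> > 0" and "d > 0"
    and "real N \<le> (\<Sum>\<alpha>=1..M. Z \<alpha>) + 1"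
  shows "\<exists>x. is_arg_min (total_potential M R Z N) (\<lambda>x. x \<in> admissible M R d N) x"
  using assms(4)
proof (induction N)
  case 0
  \<comment> \<open>The only tuple of length 0.\<close>
  have "is_arg_min (total_potential M R Z 0) (\<lambda>x. x \<in> admissible M R d 0) (\<lambda>_. undefined)"
    by (auto simp: is_arg_min_def admissible_def total_potential_eq_energy)
  then show ?case
    by blast
next
  case (Suc n)
  then obtain x where min: "is_arg_min (total_potential M R Z n) (\<lambda>x. x \<in> admissible M R d n) x"
    by auto
  then have x: "x \<in> admissible M R d n"
    by (simp add: is_arg_min_def)
  let ?J = "{1..n}"
  let ?K = "{1..M} <+> ?J"
  \<comment> \<open>By the triangle inequality, a point farther than this from the first nucleus is
    farther than \<open>d\<close> from every nucleus and every electron.\<close>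
  define \<rho> where "\<rho> = d + (\<Sum>k\<in>?K. norm (case_sum R x k - R 1))"
  have "(\<Sum>k\<in>?K. charges Z k) \<le> 0"
    using Suc.prems by (simp add: charges_def sum.Plus sum_negf)
  then have "\<exists>y. norm (y - case_sum R x (Inl 1)) > \<rho> \<and> felt_potential M R Z ?J x y < 0"
    unfolding felt_potential_def
  proof (rule coulomb_negative_far[rotated -1])
    show "Inl 1 \<in> ?K" "charges Z (Inl 1) < 0"
      using Z \<open>M \<ge> 1\<close> by (auto simp: charges_def)
    fix k l assume "k \<in> ?K" "l \<in> ?K" "case_sum R x k = case_sum R x l"
    with Z admissible_not_nucleus[OF x \<open>d > 0\<close>] show "charges Z k * charges Z l > 0"
      by (intro charges_coherent) auto
  qed auto
  then obtain y where y: "norm (y - R 1) > \<rho>" "felt_potential M R Z ?J x y < 0"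
    by auto
  have far: "d < norm (y - case_sum R x k)" if "k \<in> ?K" for k
    using member_le_sum[of k ?K "\<lambda>k. norm (case_sum R x k - R 1)"] that y(1)
      norm_triangle_ineq[of "y - case_sum R x k" "case_sum R x k - R 1"]
    by (simp add: \<rho>_def)
  have y_off: "y \<notin> R ` {1..M}" "y \<notin> x ` ?J"
    using far[of "Inl _"] far[of "Inr _"] \<open>d > 0\<close> by force+
  define u where "u = x(Suc n := y)"
  have "u \<in> admissible M R d (Suc n)"
    using x far[of "Inl _"] unfolding u_def admissible_def
    by (force simp: PiE_iff extensional_def le_Suc_eq)
  moreover have "total_potential M R Z (Suc n) u < total_potential M R Z n x"
  proof -
    obtain e where e: "energy M R Z ?J x = ereal e"
      using energy_real[of ?J x R M Z] minimizer_inj_on[OF \<open>d > 0\<close> min] admissible_not_nucleus[OF x \<open>d > 0\<close>]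
      by auto
    have "{1..Suc n} = insert (Suc n) ?J"
      by auto
    then have "total_potential M R Z (Suc n) u = energy M R Z ?J u +
        (ext_potential M R Z (u (Suc n)) + (\<Sum>j\<in>?J. 1 / ereal (norm (u (Suc n) - u j))))"
      by (simp add: total_potential_eq_energy energy_insert)
    also have "energy M R Z ?J u = energy M R Z ?J x"
      by (rule energy_cong) (simp add: u_def)
    also have "(\<Sum>j\<in>?J. 1 / ereal (norm (u (Suc n) - u j))) = (\<Sum>j\<in>?J. 1 / ereal (norm (y - x j)))"
      by (intro sum.cong) (auto simp: u_def)
    also have "u (Suc n) = y"
      by (simp add: u_def)
    finally show ?thesis
      using y(2) y_off e by (simp add: interaction_eq_felt_potential total_potential_eq_energy)
  qed
  ultimately show ?case
    by (intro minimizer_Suc[OF \<open>d > 0\<close> min])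
qed

theorem proposition1p1:
  fixes M :: nat and R :: "nat \<Rightarrow> real ^ 3" and Z :: "nat \<Rightarrow> real" and d :: real
  assumes "M \<ge> 1" and "\<forall>\<alpha>\<in>{1..M}. Z \<alpha> > 0" and "d > 0"
  shows "(\<forall>N::nat. real N \<le> (\<Sum>\<alpha>=1..M. Z \<alpha>) + 1 \<longrightarrow>
            (\<exists>x. is_arg_min (total_potential M R Z N) (\<lambda>x. x \<in> admissible M R d N) x)) \<and>
         (\<forall>(N::nat) x. is_arg_min (total_potential M R Z N) (\<lambda>x. x \<in> admissible M R d N) x \<longrightarrow>
            (\<forall>i\<in>{1..N}. x i \<in> (\<Union>\<alpha>\<in>{1..M}. sphere (R \<alpha>) d)))"
  using minimizer_exists[OF assms(1) _ assms(3)] minimizer_on_spheres[OF assms(1) _ assms(3)] assms(2)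
  by blast

end
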